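(* For every $n\geq 1$ and every $P\in\mathcal{D}_n^{h,\geq}$, $$\#DUU(P)=\#UF^+D(\phi(P))+\#UD(\phi(P))+\delta_{F^n}(\phi(P))-1,$$ where $\delta_{F^n}(Q)=1$ if $Q=F^n$ and $\delta_{F^n}(Q)=0$ otherwise.
   Context: A Motzkin path of length $n$ is a word in the steps $U=(1,1)$, $D=(1,-1)$, $F=(1,0)$ forming a lattice path from $(0,0)$ to $(n,0)$ never going below the $x$-axis; $\mathcal{M}_n$ is the set of them. A Dyck path of semilength $n$ is a Motzkin path of length $2n$ without $F$ steps. Every nonempty Dyck path has a unique first return decomposition $P=U\alpha D\beta$ with $\alpha,\beta$ Dyck paths; $h$ denotes maximal height. $\mathcal{D}^{h,\geq}$ is defined recursively: it contains the empty path $\epsilon$, and $P=U\alpha D\beta$ belongs to it iff $\alpha,\beta\in\mathcal{D}^{h,\geq}$ and $h(U\alpha D)\geq h(\beta)$; $\mathcal{D}_n^{h,\geq}$ is the subset of semilength $n$. The bijection $\phi:\mathcal{D}_n^{h,\geq}\to\mathcal{M}_n$ is defined by $\phi(\epsilon)=\epsilon$, $\phi(\alpha UD)=\phi(\alpha)F$, $\phi(\alpha UU\beta D\gamma D)=\phi(\alpha)\phi(\gamma)U\phi(\beta)D$. For a word $X$, $\#X(P)$ is the number of occurrences of $X$ as consecutive steps in $P$. For words $Y,Z$ and a step $S$, $\#YS^+Z(P)=\sum_{k\geq 1}\#YS^kZ(P)$, where $S^k$ is $k$ consecutive copies of $S$. *)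

theory Defs
  imports Complex_Main
begin

datatype step = U | D | F

fun rise :: "step \<Rightarrow> int" where
  "rise U = 1"
| "rise D = -1"
| "rise F = 0"

text \<open>The ordinate of the end point of a path that starts on the \<open>x\<close>-axis.\<close>

definition altitude :: "step list \<Rightarrow> int" where
  "altitude P = sum_list (map rise P)"

definition motzkin :: "step list \<Rightarrow> bool" where
  "motzkin P \<longleftrightarrow> altitude P = 0 \<and> (\<forall>k\<le>length P. 0 \<le> altitude (take k P))"

definition dyck :: "step list \<Rightarrow> bool" where
  "dyck P \<longleftrightarrow> motzkin P \<and> F \<notin> set P"

definition max_height :: "step list \<Rightarrow> int" where
  "max_height P = Max ((\<lambda>k. altitude (take k P)) ` {..length P})"

text \<open>Every member is a Dyck path, and \<open>U \<alpha> D \<beta>\<close> below is its first return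
  decomposition.\<close>

inductive_set hdyck :: "step list set" where
  empty: "[] \<in> hdyck"
| first_return: "\<lbrakk>\<alpha> \<in> hdyck; \<beta> \<in> hdyck; max_height ([U] @ \<alpha> @ [D]) \<ge> max_height \<beta>\<rbrakk>
    \<Longrightarrow> [U] @ \<alpha> @ [D] @ \<beta> \<in> hdyck"

definition hdyck_semilength :: "nat \<Rightarrow> step list set" where
  "hdyck_semilength n = {P \<in> hdyck. length P = 2 * n}"

definition occ :: "'a list \<Rightarrow> 'a list \<Rightarrow> nat" where
  "occ X P = card {i. i + length X \<le> length P \<and> take (length X) (drop i P) = X}"

text \<open>The number of occurrences of \<open>Y S\<^sup>k Z\<close>, summed over all \<open>k \<ge> 1\<close>. Only finitely many
  summands are nonzero, since \<open>Y S\<^sup>k Z\<close> is longer than \<open>P\<close> for large \<open>k\<close>.\<close>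

definition occ_plus :: "'a list \<Rightarrow> 'a \<Rightarrow> 'a list \<Rightarrow> 'a list \<Rightarrow> nat" where
  "occ_plus Y S Z P = (\<Sum>k. occ (Y @ replicate (Suc k) S @ Z) P)"

lemma occ_plus_eq_sum:
  "occ_plus Y S Z P = (\<Sum>k=1..length P. occ (Y @ replicate k S @ Z) P)"
proof -
  have zero: "occ (Y @ replicate (Suc k) S @ Z) P = 0" if "k \<notin> {..<length P}" for k
    using that by (auto simp: occ_def)
  have "occ_plus Y S Z P = (\<Sum>k<length P. occ (Y @ replicate (Suc k) S @ Z) P)"
    unfolding occ_plus_def by (rule suminf_finite) (use zero in auto)
  also have "\<dots> = (\<Sum>k=1..length P. occ (Y @ replicate k S @ Z) P)"
    using sum.atLeast1_atMost_eq[of "\<lambda>k. occ (Y @ replicate k S @ Z) P" "length P"] by simp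
  finally show ?thesis .
qed

definition delta_flat :: "nat \<Rightarrow> step list \<Rightarrow> int" where
  "delta_flat n Q = (if Q = replicate n F then 1 else 0)"

lemma altitude_simps [simp]:
  "altitude [] = 0"
  "altitude (s # P) = rise s + altitude P"
  "altitude (P @ Q) = altitude P + altitude Q"
  by (simp_all add: altitude_def)

lemma dyck_iff:
  "dyck P \<longleftrightarrow> altitude P = 0 \<and> (\<forall>xs ys. P = xs @ ys \<longrightarrow> 0 \<le> altitude xs) \<and> F \<notin> set P"
proof -
  have "(\<forall>k\<le>length P. 0 \<le> altitude (take k P)) \<longleftrightarrow> (\<forall>xs ys. P = xs @ ys \<longrightarrow> 0 \<le> altitude xs)"
    (is "?l \<longleftrightarrow> ?r")
  proof
    assume l: ?l
    show ?r
    proof (intro allI impI)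
      fix xs ys assume "P = xs @ ys"
      with l[rule_format, of "length xs"] show "0 \<le> altitude xs" by simp
    qed
  next
    assume ?r
    then show ?l by (metis append_take_drop_id)
  qed
  then show ?thesis by (auto simp: dyck_def motzkin_def)
qed

lemma dyck_Nil [simp]: "dyck []"
  by (simp add: dyck_iff)

lemma dyck_append:
  assumes "dyck P" "dyck Q"
  shows "dyck (P @ Q)"
  using assms unfolding dyck_iff by (auto simp: append_eq_append_conv2)

lemma dyck_lift:
  assumes "dyck P"
  shows "dyck ([U] @ P @ [D])"
proof -
  have "0 \<le> altitude xs" if eq: "[U] @ P @ [D] = xs @ ys" for xs ys
  proof (cases xs)
    case (Cons a zs)
    with eq have a: "a = U" and P: "P @ [D] = zs @ ys" by auto
    from P have "(\<exists>us. P = zs @ us) \<or> zs = P @ [D]"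
      by (auto simp: append_eq_append_conv2 Cons_eq_append_conv)
    then show ?thesis
      using assms Cons a by (auto simp: dyck_iff)
  qed simp
  then show ?thesis
    using assms by (auto simp: dyck_iff)
qed

lemma hdyck_imp_dyck: "P \<in> hdyck \<Longrightarrow> dyck P"
proof (induction rule: hdyck.induct)
  case (first_return \<alpha> \<beta>)
  then show ?case using dyck_append[OF dyck_lift[of \<alpha>], of \<beta>] by simp
qed simp

lemma first_return_exists:
  assumes "dyck P" "P \<noteq> []"
  shows "\<exists>\<beta> \<gamma>. P = [U] @ \<beta> @ [D] @ \<gamma> \<and> dyck \<beta> \<and> dyck \<gamma>"
proof -
  from assms(2) obtain s Q where P: "P = s # Q" by (cases P) auto
  have pre: "0 \<le> altitude xs" if "P = xs @ ys" for xs ys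
    using assms(1) that unfolding dyck_iff by blast
  have noF: "F \<notin> set P" and alt: "altitude P = 0"
    using assms(1) by (auto simp: dyck_iff)
  have "s = U"
    using pre[of "[s]" Q] P noF by (cases s) auto
  with P alt have Q: "altitude Q = -1" by simp
  define k where "k = (LEAST k. altitude (take k Q) < 0)"
  have k: "altitude (take k Q) < 0"
    unfolding k_def by (rule LeastI[of _ "length Q"]) (simp add: Q)
  have small: "0 \<le> altitude (take j Q)" if "j < k" for j
    using not_less_Least[of j "\<lambda>k. altitude (take k Q) < 0"] that by (auto simp: k_def)
  have "k \<noteq> 0" using k by (intro notI) simp
  then obtain m where m: "k = Suc m" by (cases k) auto
  have mQ: "m < length Q"
    using small[of m] k m by (cases "m < length Q") auto
  define \<beta> \<gamma> where "\<beta> = take m Q" and "\<gamma> = drop (Suc m) Q"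
  have split: "Q = \<beta> @ [Q ! m] @ \<gamma>"
    using id_take_nth_drop[OF mQ] by (simp add: \<beta>_def \<gamma>_def)
  have "altitude \<beta> + rise (Q ! m) < 0"
    using k m mQ by (simp add: \<beta>_def take_Suc_conv_app_nth)
  moreover have "0 \<le> altitude \<beta>" using small[of m] m by (simp add: \<beta>_def)
  ultimately have D: "Q ! m = D" and b0: "altitude \<beta> = 0"
    by (cases "Q ! m"; simp)+
  have eq: "P = [U] @ \<beta> @ [D] @ \<gamma>" using P split D \<open>s = U\<close> by simp
  have "dyck \<beta>"
    unfolding dyck_iff
  proof (intro conjI allI impI)
    fix xs ys assume b: "\<beta> = xs @ ys"
    have "length xs \<le> m" using arg_cong[OF b, of length] mQ by (simp add: \<beta>_def)
    moreover have "take (length xs) \<beta> = xs" using b by simp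
    ultimately have "take (length xs) Q = xs" by (simp add: \<beta>_def min_def)
    with small[of "length xs"] \<open>length xs \<le> m\<close> m show "0 \<le> altitude xs" by simp
  qed (use b0 noF eq in auto)
  moreover have "dyck \<gamma>"
    unfolding dyck_iff
  proof (intro conjI allI impI)
    fix xs ys assume "\<gamma> = xs @ ys"
    with eq pre[of "[U] @ \<beta> @ [D] @ xs" ys] b0 show "0 \<le> altitude xs" by simp
  qed (use b0 noF eq alt in auto)
  ultimately show ?thesis using eq by blast
qed

lemma last_return_exists:
  assumes "dyck P" "P \<noteq> []"
  shows "\<exists>\<alpha> \<delta>. P = \<alpha> @ [U] @ \<delta> @ [D] \<and> dyck \<alpha> \<and> dyck \<delta>"
  using assms
proof (induction "length P" arbitrary: P rule: less_induct)
  case less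
  obtain \<beta> \<gamma> where P: "P = [U] @ \<beta> @ [D] @ \<gamma>" "dyck \<beta>" "dyck \<gamma>"
    using first_return_exists[OF less.prems] by blast
  show ?case
  proof (cases "\<gamma> = []")
    case True
    then show ?thesis using P by (intro exI[of _ "[]"] exI[of _ \<beta>]) simp
  next
    case False
    then obtain \<alpha> \<delta> where g: "\<gamma> = \<alpha> @ [U] @ \<delta> @ [D]" "dyck \<alpha>" "dyck \<delta>"
      using less.hyps[of \<gamma>] P by auto
    then show ?thesis
      using P dyck_append[OF dyck_lift[OF P(2)] g(2)]
      by (intro exI[of _ "[U] @ \<beta> @ [D] @ \<alpha>"] exI[of _ \<delta>]) simp
  qed
qed

lemma first_return_unique:
  assumes "\<beta> @ [D] @ \<gamma> = \<beta>' @ [D] @ \<gamma>'" "dyck \<beta>" "dyck \<beta>'"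
  shows "\<beta> = \<beta>' \<and> \<gamma> = \<gamma>'"
proof -
  have no: "False" if "\<beta>1 = \<beta>2 @ [D] @ zs" "dyck \<beta>1" "dyck \<beta>2" for \<beta>1 \<beta>2 zs
  proof -
    have "0 \<le> altitude (\<beta>2 @ [D])"
      using that(1,2) unfolding dyck_iff by (metis append.assoc)
    then show False using that(3) by (simp add: dyck_iff)
  qed
  from assms(1) obtain us where
    "\<beta> = \<beta>' @ us \<and> us @ [D] @ \<gamma> = [D] @ \<gamma>' \<or> \<beta> @ us = \<beta>' \<and> [D] @ \<gamma> = us @ [D] @ \<gamma>'"
    by (auto simp: append_eq_append_conv2)
  then show ?thesis
    using no[of \<beta> \<beta>' "tl us"] no[of \<beta>' \<beta> "tl us"] assms(2,3) by (cases us) auto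
qed

lemma last_return_unique:
  assumes "\<alpha> @ [U] @ \<delta> @ [D] = \<alpha>' @ [U] @ \<delta>' @ [D]" "dyck \<alpha>" "dyck \<alpha>'" "dyck \<delta>" "dyck \<delta>'"
  shows "\<alpha> = \<alpha>' \<and> \<delta> = \<delta>'"
proof -
  have no: "False" if "\<alpha>1 = \<alpha>2 @ [U] @ zs" "\<delta>2 = zs @ ws" "dyck \<alpha>1" "dyck \<alpha>2" "dyck \<delta>2"
    for \<alpha>1 \<alpha>2 \<delta>2 zs ws
  proof -
    have "0 \<le> altitude zs" using that(2,5) by (simp add: dyck_iff)
    then show False using that(1,3,4) by (simp add: dyck_iff)
  qed
  from assms(1) have "\<alpha> @ [U] @ \<delta> = \<alpha>' @ [U] @ \<delta>'" by simp
  then obtain us where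
    "\<alpha> = \<alpha>' @ us \<and> us @ [U] @ \<delta> = [U] @ \<delta>' \<or> \<alpha> @ us = \<alpha>' \<and> [U] @ \<delta> = us @ [U] @ \<delta>'"
    by (auto simp: append_eq_append_conv2)
  then show ?thesis
    using no[of \<alpha> \<alpha>' "tl us" \<delta>'] no[of \<alpha>' \<alpha> "tl us" \<delta>] assms(2-5) by (cases us) auto
qed

lemma phi_decomposition:
  assumes "dyck P" "P \<noteq> []"
  shows "(\<exists>\<alpha>. dyck \<alpha> \<and> P = \<alpha> @ [U, D]) \<or>
    (\<exists>\<alpha> \<beta> \<gamma>. dyck \<alpha> \<and> dyck \<beta> \<and> dyck \<gamma> \<and> P = \<alpha> @ [U, U] @ \<beta> @ [D] @ \<gamma> @ [D])"
proof -
  obtain \<alpha> \<delta> where P: "P = \<alpha> @ [U] @ \<delta> @ [D]" "dyck \<alpha>" "dyck \<delta>"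
    using last_return_exists[OF assms] by blast
  show ?thesis
  proof (cases "\<delta> = []")
    case True
    with P show ?thesis by auto
  next
    case False
    then obtain \<beta> \<gamma> where "\<delta> = [U] @ \<beta> @ [D] @ \<gamma>" "dyck \<beta>" "dyck \<gamma>"
      using first_return_exists[OF P(3)] by blast
    with P have "dyck \<alpha> \<and> dyck \<beta> \<and> dyck \<gamma> \<and> P = \<alpha> @ [U, U] @ \<beta> @ [D] @ \<gamma> @ [D]" by simp
    then show ?thesis by blast
  qed
qed

lemma phi_decomposition_unique:
  assumes "\<alpha> @ [U, U] @ \<beta> @ [D] @ \<gamma> @ [D] = \<alpha>' @ [U, U] @ \<beta>' @ [D] @ \<gamma>' @ [D]"
    and "dyck \<alpha>" "dyck \<beta>" "dyck \<gamma>" "dyck \<alpha>'" "dyck \<beta>'" "dyck \<gamma>'"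
  shows "\<alpha> = \<alpha>' \<and> \<beta> = \<beta>' \<and> \<gamma> = \<gamma>'"
proof -
  have d: "dyck ([U] @ \<beta> @ [D] @ \<gamma>)" "dyck ([U] @ \<beta>' @ [D] @ \<gamma>')"
    using dyck_append[OF dyck_lift[of \<beta>], of \<gamma>] dyck_append[OF dyck_lift[of \<beta>'], of \<gamma>'] assms
    by simp_all
  have "\<alpha> = \<alpha>' \<and> [U] @ \<beta> @ [D] @ \<gamma> = [U] @ \<beta>' @ [D] @ \<gamma>'"
    using last_return_unique[OF _ assms(2,5) d] assms(1) by simp
  with first_return_unique[of \<beta> \<gamma> \<beta>' \<gamma>'] assms show ?thesis by simp
qed

lemma phi_decomposition_disjoint:
  assumes "\<alpha> @ [U, D] = \<alpha>' @ [U, U] @ \<beta>' @ [D] @ \<gamma>' @ [D]"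
    and "dyck \<alpha>" "dyck \<alpha>'" "dyck \<beta>'" "dyck \<gamma>'"
  shows False
proof -
  have "dyck ([U] @ \<beta>' @ [D] @ \<gamma>')"
    using dyck_append[OF dyck_lift[of \<beta>'], of \<gamma>'] assms by simp
  then show False
    using last_return_unique[of \<alpha> "[]" \<alpha>' "[U] @ \<beta>' @ [D] @ \<gamma>'"] assms by simp
qed

lemma dyck_phi_args:
  "dyck \<alpha> \<Longrightarrow> dyck (\<alpha> @ [U, D])"
  "dyck \<alpha> \<Longrightarrow> dyck \<beta> \<Longrightarrow> dyck \<gamma> \<Longrightarrow> dyck (\<alpha> @ [U, U] @ \<beta> @ [D] @ \<gamma> @ [D])"
  using dyck_append[of \<alpha> "[U, D]"] dyck_lift[of "[]"]
    dyck_append[of \<alpha> "[U] @ ([U] @ \<beta> @ [D] @ \<gamma>) @ [D]"]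
    dyck_lift[OF dyck_append[OF dyck_lift[of \<beta>], of \<gamma>]]
  by simp_all

lemma max_height_prefix: "max_height P \<le> max_height (P @ Q)"
proof -
  have "(\<lambda>k. altitude (take k P)) ` {..length P} \<subseteq> (\<lambda>k. altitude (take k (P @ Q))) ` {..length (P @ Q)}"
  proof (rule image_subsetI)
    fix k assume "k \<in> {..length P}"
    then show "altitude (take k P) \<in> (\<lambda>k. altitude (take k (P @ Q))) ` {..length (P @ Q)}"
      by (intro image_eqI[of _ _ k]) auto
  qed
  then show ?thesis unfolding max_height_def by (rule Max_mono) auto
qed

lemma hdyck_first_return:
  assumes "[U] @ \<alpha> @ [D] @ \<beta> \<in> hdyck" "dyck \<alpha>"
  shows "\<alpha> \<in> hdyck \<and> \<beta> \<in> hdyck"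
  using assms(1)
proof cases
  case (first_return \<alpha>' \<beta>')
  then show ?thesis
    using first_return_unique[of \<alpha> \<beta> \<alpha>' \<beta>'] assms(2) hdyck_imp_dyck by auto
qed simp

lemma hdyck_last_return:
  assumes "\<alpha> @ [U] @ \<delta> @ [D] \<in> hdyck" "dyck \<alpha>" "dyck \<delta>"
  shows "\<alpha> \<in> hdyck \<and> \<delta> \<in> hdyck"
  using assms
proof (induction "\<alpha> @ [U] @ \<delta> @ [D]" arbitrary: \<alpha> \<delta> rule: hdyck.induct)
  case (first_return a b)
  have a: "dyck a" and b: "dyck b" using first_return.hyps hdyck_imp_dyck by auto
  show ?case
  proof (cases "b = []")
    case True
    then show ?thesis
      using last_return_unique[of "[]" a \<alpha> \<delta>] first_return hdyck.empty a by auto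
  next
    case False
    then obtain \<alpha>' \<delta>' where b': "b = \<alpha>' @ [U] @ \<delta>' @ [D]" "dyck \<alpha>'" "dyck \<delta>'"
      using last_return_exists[OF b] by blast
    then have IH: "\<alpha>' \<in> hdyck" "\<delta>' \<in> hdyck" using first_return.hyps by blast+
    have "dyck ([U] @ a @ [D] @ \<alpha>')" using dyck_append[OF dyck_lift[OF a] b'(2)] by simp
    then have eq: "\<alpha> = [U] @ a @ [D] @ \<alpha>'" "\<delta> = \<delta>'"
      using last_return_unique[of "[U] @ a @ [D] @ \<alpha>'" \<delta>' \<alpha> \<delta>] first_return b' by auto
    have "max_height \<alpha>' \<le> max_height ([U] @ a @ [D])"
      using max_height_prefix[of \<alpha>' "[U] @ \<delta>' @ [D]"] first_return.hyps b' by simp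
    then show ?thesis using eq IH hdyck.first_return[of a \<alpha>'] first_return.hyps by simp
  qed
qed simp

lemma hdyck_phi_args:
  "\<alpha> @ [U, D] \<in> hdyck \<Longrightarrow> dyck \<alpha> \<Longrightarrow> \<alpha> \<in> hdyck"
  "\<alpha> @ [U, U] @ \<beta> @ [D] @ \<gamma> @ [D] \<in> hdyck \<Longrightarrow> dyck \<alpha> \<Longrightarrow> dyck \<beta> \<Longrightarrow> dyck \<gamma> \<Longrightarrow>
    \<alpha> \<in> hdyck \<and> \<beta> \<in> hdyck \<and> \<gamma> \<in> hdyck"
  using hdyck_last_return[of \<alpha> "[]"] hdyck_last_return[of \<alpha> "[U] @ \<beta> @ [D] @ \<gamma>"]
    dyck_append[OF dyck_lift[of \<beta>], of \<gamma>] hdyck_first_return[of \<beta> \<gamma>]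
  by auto

text \<open>The recursion makes sense on all Dyck paths, so \<open>\<phi>\<close> is defined there. It restricts to
  \<^const>\<open>hdyck\<close>, because the pieces of a member are again members (\<open>hdyck_phi_args\<close>). The
  value outside the Dyck paths is arbitrary.\<close>

function phi :: "step list \<Rightarrow> step list" where
  "phi [] = []"
| "dyck \<alpha> \<Longrightarrow> phi (\<alpha> @ [U, D]) = phi \<alpha> @ [F]"
| "dyck \<alpha> \<Longrightarrow> dyck \<beta> \<Longrightarrow> dyck \<gamma> \<Longrightarrow>
    phi (\<alpha> @ [U, U] @ \<beta> @ [D] @ \<gamma> @ [D]) = phi \<alpha> @ phi \<gamma> @ [U] @ phi \<beta> @ [D]"
| "\<not> dyck P \<Longrightarrow> phi P = []"
proof goal_cases
  case (1 Q x)
  then show ?case using phi_decomposition[of x] by blast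
next
  case (7 \<alpha> \<alpha>' \<beta>' \<gamma>')
  then show ?case using phi_decomposition_disjoint by blast
next
  case (9 \<alpha> \<beta> \<gamma> \<alpha>' \<beta>' \<gamma>')
  then show ?case using phi_decomposition_unique[of \<alpha> \<beta> \<gamma> \<alpha>' \<beta>' \<gamma>'] by simp
qed (use dyck_phi_args in auto)
termination by (relation "measure length") auto

end

theory Submission
  imports Defs "HOL-Library.Sublist"
begin

text \<open>Call a factor \<open>U F\<^sup>k D\<close> with \<open>k \<ge> 0\<close> a flat peak. Flat peaks do not straddle a concatenation
  of Motzkin paths, and lifting \<open>A\<close> to \<open>U A D\<close> creates one exactly when \<open>A\<close> has only \<open>F\<close> steps.
  Hence, for \<open>P = \<alpha> U U \<beta> D \<gamma> D\<close>, the number of flat peaks of \<open>\<phi>(P)\<close> is that of \<open>\<phi>(\<alpha>)\<close> plus that of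
  \<open>\<phi>(\<gamma>)\<close> plus that of \<open>\<phi>(\<beta>)\<close>, the last one being replaced by 1 if \<open>\<phi>(\<beta>)\<close> is flat, while \<open>#DUU(P)\<close>
  is the sum over the three pieces plus 1 if \<open>\<alpha>\<close> is nonempty, plus 1 if \<open>\<gamma>\<close> starts with \<open>U U\<close>. These
  match by induction, also with the empty path included, because the height condition makes
  \<open>\<phi>(P)\<close> flat exactly when \<open>P\<close> does not start with \<open>U U\<close>, and forces a nonempty \<open>\<alpha>\<close> to start
  with \<open>U U\<close>.\<close>

lemma occ_Nil: "X \<noteq> [] \<Longrightarrow> occ X [] = 0"
  by (simp add: occ_def)

lemma occ_Cons:
  assumes "X \<noteq> []"
  shows "occ X (x # P) = of_bool (prefix X (x # P)) + occ X P"
proof -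
  define S where "S P = {i. i + length X \<le> length P \<and> take (length X) (drop i P) = X}" for P
  have fin: "finite (S P)" for P
    by (rule finite_subset[of _ "{..length P}"]) (auto simp: S_def)
  have "prefix X (x # P) \<longleftrightarrow> take (length X) (x # P) = X"
    unfolding prefix_def by (metis append_eq_conv_conj)
  then have zero: "0 \<in> S (x # P) \<longleftrightarrow> prefix X (x # P)"
    using prefix_length_le[of X "x # P"] by (auto simp: S_def)
  have suc: "Suc i \<in> S (x # P) \<longleftrightarrow> i \<in> S P" for i
    by (simp add: S_def)
  have "S (x # P) = (if prefix X (x # P) then {0} else {}) \<union> Suc ` S P"
  proof (rule set_eqI)
    fix i show "i \<in> S (x # P) \<longleftrightarrow> i \<in> (if prefix X (x # P) then {0} else {}) \<union> Suc ` S P"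
      by (cases i) (auto simp: zero suc)
  qed
  then have "card (S (x # P)) = of_bool (prefix X (x # P)) + card (S P)"
    by (simp add: card_image fin)
  then show ?thesis by (simp add: occ_def S_def)
qed

text \<open>The part of a flat peak after its \<open>U\<close>: some number of \<open>F\<close>
  steps, then \<open>D\<close>. It turns the sum over k into a single scan.\<close>

fun flat_descent :: "step list \<Rightarrow> bool" where
  "flat_descent [] = False"
| "flat_descent (D # Q) = True"
| "flat_descent (U # Q) = False"
| "flat_descent (F # Q) = flat_descent Q"

fun flat_peaks :: "step list \<Rightarrow> nat" where
  "flat_peaks [] = 0"
| "flat_peaks (s # Q) = of_bool (s = U \<and> flat_descent Q) + flat_peaks Q"

text \<open>Only k equal to the number of leading \<open>F\<close> steps can match, and the length
  bound keeps that k in range.\<close>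

lemma sum_prefix_flat_descent:
  "length Q \<le> N \<Longrightarrow>
    (\<Sum>k\<le>N. of_bool (prefix (replicate k F @ [D]) Q)) = (of_bool (flat_descent Q) :: nat)"
proof (induction Q arbitrary: N rule: flat_descent.induct)
  case (4 Q)
  then obtain M where "N = Suc M" "length Q \<le> M" by (cases N) auto
  with 4 show ?case by (simp add: sum.atMost_Suc_shift del: sum.atMost_Suc)
qed (simp_all add: sum.atMost_shift)

lemma sum_occ_flat_peaks:
  "length Q \<le> N \<Longrightarrow> (\<Sum>k\<le>N. occ ([U] @ replicate k F @ [D]) Q) = flat_peaks Q"
proof (induction Q)
  case (Cons s Q)
  then show ?case
    using sum_prefix_flat_descent[of Q N]
    by (cases s) (simp_all add: occ_Cons sum.distrib del: sum_of_bool_eq)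
qed (simp add: occ_Nil)

text \<open>\<open>U D\<close> is the summand k = 0, which \<open>occ_plus\<close> leaves
  out.\<close>

lemma occ_plus_flat_peaks: "occ_plus [U] F [D] Q + occ [U, D] Q = flat_peaks Q"
  using sum_occ_flat_peaks[of Q "length Q"]
  by (simp add: occ_plus_eq_sum sum.atMost_shift sum.atLeast1_atMost_eq)

text \<open>A grammar for Motzkin paths shaped after the right-hand sides of \<open>phi\<close>, so
  that concatenation and lifting are induction cases.\<close>

inductive_set motz :: "step list set" where
  Nil: "[] \<in> motz"
| flat: "[F] \<in> motz"
| append: "A \<in> motz \<Longrightarrow> B \<in> motz \<Longrightarrow> A @ B \<in> motz"
| lift: "A \<in> motz \<Longrightarrow> U # A @ [D] \<in> motz"

lemmas phi_two_arches = phi.simps(3)[simplified]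

lemma phi_motz: "phi P \<in> motz"
proof (induction P rule: phi.induct)
  case (3 \<alpha> \<beta> \<gamma>)
  then show ?case by (auto intro!: motz.append simp: phi_two_arches motz.lift)
qed (auto intro: motz.intros)

text \<open>The first step other than \<open>F\<close> in a Motzkin path is \<open>U\<close>, which
  stops the scan; a flat \<open>A\<close> is skipped.\<close>

lemma flat_descent_append:
  "A \<in> motz \<Longrightarrow> flat_descent (A @ B) \<longleftrightarrow> set A \<subseteq> {F} \<and> flat_descent B"
  by (induction arbitrary: B rule: motz.induct) auto

text \<open>Every \<open>U\<close> of \<open>A\<close> has a later \<open>D\<close> in
  \<open>A\<close>, so the scan from it ends inside \<open>A\<close>.\<close>

lemma flat_peaks_append:
  "A \<in> motz \<Longrightarrow> flat_peaks (A @ B) = flat_peaks A + flat_peaks B"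
proof (induction arbitrary: B rule: motz.induct)
  case (append A A')
  then show ?case by (metis append.assoc add.assoc)
next
  case (lift A)
  then show ?case by (simp add: flat_descent_append)
qed auto

lemma flat_peaks_lift:
  "A \<in> motz \<Longrightarrow> flat_peaks (U # A @ [D]) = of_bool (set A \<subseteq> {F}) + flat_peaks A"
  by (simp add: flat_descent_append flat_peaks_append)

lemma flat_peaks_flat: "set Q \<subseteq> {F} \<Longrightarrow> flat_peaks Q = 0"
  by (induction Q) auto

lemma flat_peaks_phi:
  assumes "dyck \<alpha>" "dyck \<beta>" "dyck \<gamma>"
  shows "flat_peaks (phi (\<alpha> @ [U, U] @ \<beta> @ [D] @ \<gamma> @ [D])) =
    flat_peaks (phi \<alpha>) + flat_peaks (phi \<gamma>) +
    (of_bool (set (phi \<beta>) \<subseteq> {F}) + flat_peaks (phi \<beta>))"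
  using assms flat_peaks_lift[OF phi_motz, of \<beta>]
  by (simp add: phi_two_arches flat_peaks_append phi_motz del: flat_peaks.simps)

lemma length_phi: "dyck P \<Longrightarrow> 2 * length (phi P) = length P"
  by (induction P rule: phi.induct) (auto simp: phi_two_arches)

lemma dyck_endpoints:
  assumes "dyck P" "P \<noteq> []"
  shows "hd P = U" "last P = D"
proof -
  show "hd P = U" using first_return_exists[OF assms] by auto
  show "last P = D" using last_return_exists[OF assms] by auto
qed

lemma prefix_UU_dyck_append:
  assumes "dyck P" "P \<noteq> []"
  shows "prefix [U, U] (P @ Q) \<longleftrightarrow> prefix [U, U] P"
proof -
  obtain \<beta> \<gamma> where "P = [U] @ \<beta> @ [D] @ \<gamma>"
    using first_return_exists[OF assms] by blast
  then show ?thesis by (cases \<beta>) auto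
qed

text \<open>A straddling occurrence splits as \<open>D\<close>, \<open>U U\<close> or as
  \<open>D U\<close>, \<open>U\<close>; the final \<open>D\<close> of \<open>xs\<close> excludes the
  second.\<close>

lemma occ_DUU_append:
  assumes "xs \<noteq> [] \<Longrightarrow> last xs = D"
  shows "occ [D, U, U] (xs @ ys) =
    occ [D, U, U] xs + occ [D, U, U] ys + of_bool (xs \<noteq> [] \<and> prefix [U, U] ys)"
  using assms
proof (induction xs)
  case (Cons x xs)
  have "prefix [D, U, U] (x # xs @ ys) \<longleftrightarrow>
      prefix [D, U, U] (x # xs) \<or> xs = [] \<and> prefix [U, U] ys"
  proof (cases xs)
    case Nil
    with Cons.prems show ?thesis by simp
  next
    case (Cons y zs)
    with Cons.prems show ?thesis by (cases zs) auto
  qed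
  with Cons show ?case by (cases "xs = []") (auto simp: occ_Cons occ_Nil)
qed (simp add: occ_Nil)

lemma occ_DUU_dyck_append:
  "dyck P \<Longrightarrow> occ [D, U, U] (P @ Q) =
    occ [D, U, U] P + occ [D, U, U] Q + of_bool (P \<noteq> [] \<and> prefix [U, U] Q)"
  by (rule occ_DUU_append) (simp add: dyck_endpoints)

text \<open>The two indicators stand for the occurrences whose \<open>D\<close> ends \<alpha> or
  closes the arch over \<beta>.\<close>

lemma occ_DUU_phi_args:
  assumes "dyck \<alpha>" "dyck \<beta>" "dyck \<gamma>"
  shows "occ [D, U, U] (\<alpha> @ [U, D]) = occ [D, U, U] \<alpha>"
    and "occ [D, U, U] (\<alpha> @ [U, U] @ \<beta> @ [D] @ \<gamma> @ [D]) =
      occ [D, U, U] \<alpha> + of_bool (\<alpha> \<noteq> []) + occ [D, U, U] \<beta> +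
      (occ [D, U, U] \<gamma> + of_bool (prefix [U, U] \<gamma>))"
proof -
  have "prefix [U, U] (\<gamma> @ [D]) \<longleftrightarrow> prefix [U, U] \<gamma>"
    using prefix_UU_dyck_append[OF assms(3)] by (cases "\<gamma> = []") auto
  then show "occ [D, U, U] (\<alpha> @ [U, U] @ \<beta> @ [D] @ \<gamma> @ [D]) =
      occ [D, U, U] \<alpha> + of_bool (\<alpha> \<noteq> []) + occ [D, U, U] \<beta> +
      (occ [D, U, U] \<gamma> + of_bool (prefix [U, U] \<gamma>))"
    using assms by (simp add: occ_DUU_dyck_append occ_Cons occ_Nil)
qed (use assms in \<open>simp add: occ_DUU_dyck_append occ_Cons occ_Nil\<close>)

lemma altitude_le_max_height: "altitude xs \<le> max_height (xs @ ys)"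
  unfolding max_height_def by (rule Max_ge) (auto intro!: image_eqI[of _ _ "length xs"])

text \<open>If \<open>\<alpha>\<close> started with \<open>U D\<close>, the height condition would bound all later steps by height 1.\<close>

lemma hdyck_prefix_UU:
  assumes "\<alpha> @ [U, U] @ \<rho> \<in> hdyck" "dyck \<alpha>" "\<alpha> \<noteq> []"
  shows "prefix [U, U] \<alpha>"
  using assms(1)
proof cases
  case (first_return a b)
  show ?thesis
  proof (cases "a = []")
    case False
    then have "prefix [U, U] (\<alpha> @ [U, U] @ \<rho>)"
      using first_return dyck_endpoints(1)[of a] hdyck_imp_dyck by (cases a) auto
    then show ?thesis using prefix_UU_dyck_append assms(2,3) by blast
  next
    case True
    obtain \<beta> \<gamma> where \<alpha>: "\<alpha> = [U] @ \<beta> @ [D] @ \<gamma>" "dyck \<beta>" "dyck \<gamma>"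
      using first_return_exists assms(2,3) by blast
    have "b = \<gamma> @ [U, U] @ \<rho>"
      using first_return(1) True \<alpha> dyck_endpoints(1)[of \<beta>] by (cases \<beta>) auto
    \<comment> \<open>Since \<gamma> ends on the axis, this prefix of \<open>b\<close> reaches
      height 2.\<close>
    then have "altitude (\<gamma> @ [U, U]) \<le> max_height b"
      using altitude_le_max_height[of "\<gamma> @ [U, U]" \<rho>] by simp
    moreover have "max_height [U, D] = 1"
      by (simp add: max_height_def atMost_Suc)
    ultimately show ?thesis using first_return(4) True \<alpha>(3) by (simp add: dyck_iff)
  qed
qed (use assms in auto)

text \<open>A flat image arises only from the rule producing \<open>F\<close>, that is, from
  repeated \<open>U D\<close>. The other rule produces a \<open>U\<close>, and there \<alpha> is
  empty or itself starts with \<open>U U\<close>.\<close>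

lemma phi_flat_iff:
  "P \<in> hdyck \<Longrightarrow> set (phi P) \<subseteq> {F} \<longleftrightarrow> \<not> prefix [U, U] P"
proof (induction P rule: phi.induct)
  case (2 \<alpha>)
  then show ?case
    using hdyck_phi_args(1) prefix_UU_dyck_append[of \<alpha> "[U, D]"] phi.simps(2)[of "[]"]
    by (cases "\<alpha> = []") auto
next
  case (3 \<alpha> \<beta> \<gamma>)
  then have "prefix [U, U] (\<alpha> @ [U, U] @ \<beta> @ [D] @ \<gamma> @ [D])"
    using hdyck_prefix_UU[of \<alpha>] by (cases "\<alpha> = []") auto
  moreover have "\<not> set (phi (\<alpha> @ [U, U] @ \<beta> @ [D] @ \<gamma> @ [D])) \<subseteq> {F}"
    using 3(1-3) by (simp add: phi_two_arches)
  ultimately show ?case by blast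
qed (auto dest: hdyck_imp_dyck)

text \<open>Form of the identity fit for induction: the empty path counts as flat, so empty pieces
  are covered.\<close>

lemma flat_peaks_phi_eq_occ_DUU:
  "P \<in> hdyck \<Longrightarrow>
    flat_peaks (phi P) + of_bool (set (phi P) \<subseteq> {F}) = occ [D, U, U] P + 1"
proof (induction P rule: phi.induct)
  case (2 \<alpha>)
  then show ?case
    using hdyck_phi_args(1)[of \<alpha>] by (simp add: occ_DUU_phi_args flat_peaks_append phi_motz)
next
  case (3 \<alpha> \<beta> \<gamma>)
  note d = \<open>dyck \<alpha>\<close> \<open>dyck \<beta>\<close> \<open>dyck \<gamma>\<close>
  have h: "\<alpha> \<in> hdyck" "\<beta> \<in> hdyck" "\<gamma> \<in> hdyck"
    using hdyck_phi_args(2)[OF 3(7) d] by auto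
  \<comment> \<open>Flatness and an initial \<open>U U\<close> are complementary: if flat, both
    sides are 0; otherwise the 1 in \<open>IH\<close> is the indicator.\<close>
  have peaks: "flat_peaks (phi \<delta>) = occ [D, U, U] \<delta> + of_bool (prefix [U, U] \<delta>)"
    if "\<delta> \<in> hdyck" and IH: "flat_peaks (phi \<delta>) + of_bool (set (phi \<delta>) \<subseteq> {F}) = occ [D, U, U] \<delta> + 1"
    for \<delta>
    using IH phi_flat_iff[OF that(1)] flat_peaks_flat[of "phi \<delta>"] by (cases "prefix [U, U] \<delta>") auto
  have "prefix [U, U] \<alpha> \<longleftrightarrow> \<alpha> \<noteq> []"
    using hdyck_prefix_UU[of \<alpha>] 3(7) d by auto
  \<comment> \<open>For \<beta> the induction hypothesis is kept as it stands: its flatness term is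
    the peak created by lifting.\<close>
  then have "flat_peaks (phi \<alpha>) = occ [D, U, U] \<alpha> + of_bool (\<alpha> \<noteq> [])"
    "flat_peaks (phi \<gamma>) = occ [D, U, U] \<gamma> + of_bool (prefix [U, U] \<gamma>)"
    "of_bool (set (phi \<beta>) \<subseteq> {F}) + flat_peaks (phi \<beta>) = occ [D, U, U] \<beta> + 1"
    using peaks[OF h(1)] peaks[OF h(3)] 3 h by simp_all
  moreover have "\<not> set (phi (\<alpha> @ [U, U] @ \<beta> @ [D] @ \<gamma> @ [D])) \<subseteq> {F}"
    using d by (simp add: phi_two_arches)
  ultimately show ?case
    unfolding flat_peaks_phi[OF d] occ_DUU_phi_args(2)[OF d] by simp
qed (auto simp: occ_Nil dest: hdyck_imp_dyck)

theorem theorem5: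
  fixes n :: nat and P :: "step list"
  assumes "n \<ge> 1"
    and "P \<in> hdyck_semilength n"
  shows "int (occ [D, U, U] P) =
    int (occ_plus [U] F [D] (phi P)) + int (occ [U, D] (phi P)) + delta_flat n (phi P) - 1"
proof -
  have P: "P \<in> hdyck" "length P = 2 * n"
    using assms(2) by (auto simp: hdyck_semilength_def)
  have "length (phi P) = n"
    using length_phi[OF hdyck_imp_dyck[OF P(1)]] P(2) by simp
  then have "phi P = replicate n F \<longleftrightarrow> set (phi P) \<subseteq> {F}"
    by (metis in_set_replicate replicate_eqI singleton_iff subset_iff)
  then have "delta_flat n (phi P) = of_bool (set (phi P) \<subseteq> {F})"
    by (simp add: delta_flat_def)
  then show ?thesis
    using flat_peaks_phi_eq_occ_DUU[OF P(1)] occ_plus_flat_peaks[of "phi P"]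
    by (cases "set (phi P) \<subseteq> {F}") simp_all
qed

end
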